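(* Let $A=(a_{i,j})$ be a $d\times m$ $W$-positive integer matrix. Then there exist $\alpha\in\mathrm{GL}_d(\mathbb Z)$, a permutation matrix $\beta\in\mathrm{GL}_m(\mathbb Z)$ and a positive matrix $\underline A$ in row echelon form such that $\alpha A\beta=\underline A$.
   Context: $d,m$ are positive integers. A matrix (or vector) is positive if all its entries are $\ge0$. An integer matrix $A$ is $W$-positive if the lattice spanned over $\mathbb Z$ by its rows has a $\mathbb Z$-basis consisting of positive vectors. A matrix is in row echelon form if all non-zero rows are above all zero rows, and the first non-zero entry from the left of each non-zero row is strictly to the right of the first non-zero entry of the previous row. *)

theory Defs
  imports "Jordan_Normal_Form.VS_Connect"
begin

definition positive_vec :: "int vec \<Rightarrow> bool" where
  "positive_vec v \<longleftrightarrow> (\<forall>i < dim_vec v. v $ i \<ge> 0)"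

definition positive_mat :: "int mat \<Rightarrow> bool" where
  "positive_mat A \<longleftrightarrow> (\<forall>i < dim_row A. \<forall>j < dim_col A. A $$ (i, j) \<ge> 0)"

abbreviation int_span :: "nat \<Rightarrow> int vec set \<Rightarrow> int vec set" where
  "int_span m \<equiv> LinearCombinations.module.span class_ring (module_vec TYPE(int) m)"

abbreviation int_lin_dep :: "nat \<Rightarrow> int vec set \<Rightarrow> bool" where
  "int_lin_dep m \<equiv> LinearCombinations.module.lin_dep class_ring (module_vec TYPE(int) m)"

definition row_lattice :: "int mat \<Rightarrow> int vec set" where
  "row_lattice A = int_span (dim_col A) (set (rows A))"

definition int_basis :: "nat \<Rightarrow> int vec set \<Rightarrow> int vec set \<Rightarrow> bool" where
  "int_basis m L B \<longleftrightarrow> B \<subseteq> carrier_vec m \<and> \<not> int_lin_dep m B \<and> int_span m B = L"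

definition W_positive :: "int mat \<Rightarrow> bool" where
  "W_positive A \<longleftrightarrow>
     (\<exists>B. int_basis (dim_col A) (row_lattice A) B \<and> (\<forall>v \<in> B. positive_vec v))"

definition GL :: "nat \<Rightarrow> int mat set" where
  "GL n = {P \<in> carrier_mat n n. invertible_mat P}"

definition permutation_mat :: "nat \<Rightarrow> int mat \<Rightarrow> bool" where
  "permutation_mat n P \<longleftrightarrow>
     (\<exists>\<pi>. \<pi> permutes {..<n} \<and> P = mat n n (\<lambda>(i, j). if i = \<pi> j then 1 else 0))"

text \<open>Only meaningful when row \<open>i\<close> of \<open>A\<close> is non-zero.\<close>

definition leading_col :: "int mat \<Rightarrow> nat \<Rightarrow> nat" where
  "leading_col A i = (LEAST j. j < dim_col A \<and> A $$ (i, j) \<noteq> 0)"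

text \<open>Unlike the library's \<open>row_echelon_form\<close>, this is the non-reduced notion: pivots need not
  be \<open>1\<close>, and entries above a pivot are unrestricted.\<close>

definition row_echelon :: "int mat \<Rightarrow> bool" where
  "row_echelon A \<longleftrightarrow>
     (\<forall>i < dim_row A. \<forall>j < dim_row A.
        row A i \<noteq> 0\<^sub>v (dim_col A) \<longrightarrow> row A j = 0\<^sub>v (dim_col A) \<longrightarrow> i < j) \<and>
     (\<forall>i. Suc i < dim_row A \<longrightarrow> row A (Suc i) \<noteq> 0\<^sub>v (dim_col A) \<longrightarrow>
        leading_col A i < leading_col A (Suc i))"

end

theory Submission
  imports Defs "Jordan_Normal_Form.Gauss_Jordan_Elimination"
begin

text \<open>
  Let \<open>L\<close> be the row lattice of \<open>A\<close>. Each column of \<open>A\<close> that is not zero is positive in some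
  vector of a positive basis, so adding up such basis vectors gives a vector \<open>w \<in> L\<close> with
  \<open>w \<ge> 0\<close> that is zero only at zero columns of \<open>A\<close> (\<open>W_positive_vector\<close>). The
  existence of such a \<open>w\<close> survives the deletion of columns, which makes an induction on the number
  of columns possible (\<open>positive_echelon_form_exists\<close>), which builds the
  echelon form from its last non-zero row upwards.

  Geometrically, the last non-zero row should lie on an extreme ray of the cone of non-negative
  vectors in the real span of \<open>L\<close>. So choose a non-zero \<open>v \<ge> 0\<close> in \<open>L\<close> whose support \<open>T\<close> has the
  least possible size. Then every vector of \<open>L\<close> supported in \<open>T\<close> is a rational multiple of \<open>v\<close>
  (\<open>minimal_support_proportional\<close>): otherwise an integer combination of it with \<open>v\<close> would be
  non-zero and non-negative with smaller support.

  Delete the columns in \<open>T\<close>. By induction, row operations and an ordering of the remaining columns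
  give a positive echelon form with \<open>r\<close> non-zero rows. Put the columns of \<open>T\<close> back on the right. The
  rows from \<open>r\<close> on now are supported in \<open>T\<close>, hence multiples of \<open>v\<close>, and the Euclidean algorithm
  in one column of \<open>T\<close> (\<open>column_elimination\<close>) clears all of them but row \<open>r\<close>, which becomes a
  non-negative multiple of \<open>v\<close>. It is not zero, because otherwise \<open>v\<close> would be a combination of
  rows that are independent already outside \<open>T\<close>, where \<open>v\<close> vanishes. So row \<open>r\<close> is positive on
  all of \<open>T\<close> and zero elsewhere, and adding a large multiple of it to the rows above makes these
  non-negative on \<open>T\<close> without changing their other entries.

  Families \<open>nat \<Rightarrow> nat \<Rightarrow> int\<close> of rows, indexed by row and column, serve in place of matrices until
  the last step. In this way a set of columns can be split and reordered without renumbering, and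
  the permutation matrix is read off once from the final list of columns.
\<close>

section \<open>Integer combinations of finitely many rows\<close>

definition row_combinations :: "nat \<Rightarrow> (nat \<Rightarrow> nat \<Rightarrow> int) \<Rightarrow> (nat \<Rightarrow> int) set" where
  "row_combinations d a = {x. \<exists>c. \<forall>j. x j = (\<Sum>i<d. c i * a i j)}"

lemma row_combinations_row:
  assumes "i < d"
  shows "a i \<in> row_combinations d a"
proof -
  have "a i j = (\<Sum>k<d. (if k = i then 1 else 0) * a k j)" for j
    using assms by (simp add: if_distrib[of "\<lambda>x. x * _"] cong: if_cong)
  then show ?thesis
    unfolding row_combinations_def by (intro CollectI exI[of _ "\<lambda>k. if k = i then 1 else 0"] allI)
qed

lemma row_combinations_lincomb:
  assumes "x \<in> row_combinations d a" "y \<in> row_combinations d a"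
  shows "(\<lambda>j. s * x j + t * y j) \<in> row_combinations d a"
proof -
  obtain c e where "\<And>j. x j = (\<Sum>i<d. c i * a i j)" "\<And>j. y j = (\<Sum>i<d. e i * a i j)"
    using assms unfolding row_combinations_def by blast
  then have "s * x j + t * y j = (\<Sum>i<d. (s * c i + t * e i) * a i j)" for j
    by (simp add: sum_distrib_left sum.distrib algebra_simps)
  then show ?thesis
    unfolding row_combinations_def by (intro CollectI exI[of _ "\<lambda>i. s * c i + t * e i"]) auto
qed

lemma row_combinations_sum:
  assumes "finite K" "\<And>k. k \<in> K \<Longrightarrow> x k \<in> row_combinations d a"
  shows "(\<lambda>j. \<Sum>k\<in>K. x k j) \<in> row_combinations d a"
  using assms
proof (induction K rule: finite_induct)
  case empty
  show ?case
    unfolding row_combinations_def by (intro CollectI exI[of _ "\<lambda>_. 0"]) simp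
next
  case (insert k K)
  then show ?case
    using row_combinations_lincomb[of "x k" d a "\<lambda>j. \<Sum>k\<in>K. x k j" 1 1] by simp
qed

lemma row_combinations_mono:
  assumes "\<And>i. i < d \<Longrightarrow> a i \<in> row_combinations d b"
  shows "row_combinations d a \<subseteq> row_combinations d b"
proof
  fix x assume "x \<in> row_combinations d a"
  then obtain c where c: "\<And>j. x j = (\<Sum>i<d. c i * a i j)"
    unfolding row_combinations_def by blast
  have "(\<lambda>j. c i * a i j) \<in> row_combinations d b" if "i < d" for i
    using row_combinations_lincomb[OF assms assms, OF that that, of "c i" 0] by simp
  then have "(\<lambda>j. \<Sum>i\<in>{..<d}. c i * a i j) \<in> row_combinations d b"
    by (intro row_combinations_sum) auto
  moreover have "x = (\<lambda>j. \<Sum>i\<in>{..<d}. c i * a i j)"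
    using c by auto
  ultimately show "x \<in> row_combinations d b" by simp
qed

section \<open>Unimodular row operations\<close>

text \<open>Reachability by elementary operations that are invertible over \<open>\<int>\<close>. Interchanging two rows is
  a composition of these.\<close>

inductive row_equiv :: "nat \<Rightarrow> (nat \<Rightarrow> nat \<Rightarrow> int) \<Rightarrow> (nat \<Rightarrow> nat \<Rightarrow> int) \<Rightarrow> bool"
  for d a where
  refl: "row_equiv d a a"
| add: "row_equiv d a (b(k := \<lambda>j. b k j + c * b l j))"
    if "row_equiv d a b" "k < d" "l < d" "k \<noteq> l"
| negate: "row_equiv d a (b(k := \<lambda>j. - b k j))" if "row_equiv d a b" "k < d"

lemma row_equiv_trans:
  assumes "row_equiv d b c" "row_equiv d a b"
  shows "row_equiv d a c"
  using assms by induction (auto intro: row_equiv.intros)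

lemma row_equiv_lattice:
  assumes "row_equiv d a b"
  shows "row_combinations d b = row_combinations d a"
  using assms
proof induction
  case refl
  show ?case ..
next
  case (add b k l c)
  let ?b = "b(k := \<lambda>j. b k j + c * b l j)"
  have "?b i \<in> row_combinations d b" if "i < d" for i
    using row_combinations_lincomb[OF row_combinations_row[OF add.hyps(2)] row_combinations_row[OF add.hyps(3)], of 1 b c]
      row_combinations_row[OF that, of b] by simp
  moreover have "b i \<in> row_combinations d ?b" if "i < d" for i
    using row_combinations_lincomb[OF row_combinations_row[OF add.hyps(2)] row_combinations_row[OF add.hyps(3)], of 1 ?b "-c"]
      row_combinations_row[OF that, of ?b] add.hyps(4) by (cases "i = k") auto
  ultimately show ?case
    using add.IH row_combinations_mono[of d ?b b] row_combinations_mono[of d b ?b] by blast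
next
  case (negate b k)
  let ?b = "b(k := \<lambda>j. - b k j)"
  have "?b i \<in> row_combinations d b" if "i < d" for i
    using row_combinations_lincomb[OF row_combinations_row[OF negate.hyps(2)] row_combinations_row[OF negate.hyps(2)], of "-1" b 0]
      row_combinations_row[OF that, of b] by simp
  moreover have "b i \<in> row_combinations d ?b" if "i < d" for i
    using row_combinations_lincomb[OF row_combinations_row[OF negate.hyps(2)] row_combinations_row[OF negate.hyps(2)], of "-1" ?b 0]
      row_combinations_row[OF that, of ?b] by (cases "i = k") auto
  ultimately show ?case
    using negate.IH row_combinations_mono[of d ?b b] row_combinations_mono[of d b ?b] by blast
qed

lemma row_equiv_add_to_upper_rows:
  assumes "r < d" "n \<le> r"
  shows "row_equiv d b (\<lambda>i. if i < n then (\<lambda>j. b i j + N * b r j) else b i)"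
  using assms(2)
proof (induction n)
  case 0
  show ?case by (simp add: row_equiv.refl)
next
  case (Suc n)
  let ?b = "\<lambda>i. if i < n then (\<lambda>j. b i j + N * b r j) else b i"
  have "row_equiv d b (?b(n := \<lambda>j. ?b n j + N * ?b r j))"
    using Suc assms(1) by (intro row_equiv.add) auto
  moreover have "?b(n := \<lambda>j. ?b n j + N * ?b r j)
      = (\<lambda>i. if i < Suc n then (\<lambda>j. b i j + N * b r j) else b i)"
    using Suc.prems by (auto simp: fun_eq_iff less_Suc_eq)
  ultimately show ?case by simp
qed

text \<open>The Euclidean algorithm on the entries of column \<open>p\<close> in the rows from \<open>r\<close> on. Since it only
  combines these rows with each other, a column that vanishes in all of them continues to do so. In
  the main induction this keeps the columns already in echelon form intact.\<close>

lemma column_elimination: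
  assumes "r < d"
  shows "\<exists>b'. row_equiv d b b' \<and> (\<forall>i<r. b' i = b i) \<and> b' r p \<ge> 0 \<and>
    (\<forall>i. r < i \<and> i < d \<longrightarrow> b' i p = 0) \<and>
    (\<forall>j. (\<forall>i\<in>{r..<d}. b i j = 0) \<longrightarrow> (\<forall>i\<in>{r..<d}. b' i j = 0))"
proof (induction "\<Sum>i\<in>{r..<d}. nat \<bar>b i p\<bar>" arbitrary: b rule: less_induct)
  case less
  show ?case
  proof (cases "\<exists>k\<in>{r..<d}. \<exists>l\<in>{r..<d}. k \<noteq> l \<and> b l p \<noteq> 0 \<and> \<bar>b l p\<bar> \<le> \<bar>b k p\<bar>")
    case True
    then obtain k l where kl: "k \<in> {r..<d}" "l \<in> {r..<d}" "k \<noteq> l" "b l p \<noteq> 0"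
      "\<bar>b l p\<bar> \<le> \<bar>b k p\<bar>" by blast
    \<comment> \<open>This choice gives \<open>\<bar>b k p + c * b l p\<bar> = \<bar>b k p\<bar> - \<bar>b l p\<bar>\<close>.\<close>
    define c where "c = - sgn (b k p) * sgn (b l p)"
    define b1 where "b1 = b(k := \<lambda>j. b k j + c * b l j)"
    have eq: "row_equiv d b b1"
      unfolding b1_def using kl by (intro row_equiv.add row_equiv.refl) auto
    have dec: "\<bar>b k p + c * b l p\<bar> < \<bar>b k p\<bar>"
      using kl(4,5) unfolding c_def by (auto simp: sgn_if abs_if split: if_splits)
    have "(\<Sum>i\<in>{r..<d}. nat \<bar>b1 i p\<bar>) < (\<Sum>i\<in>{r..<d}. nat \<bar>b i p\<bar>)"
    proof (rule sum_strict_mono_ex1)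
      show "\<forall>i\<in>{r..<d}. nat \<bar>b1 i p\<bar> \<le> nat \<bar>b i p\<bar>"
        using dec by (auto simp: b1_def)
      show "\<exists>i\<in>{r..<d}. nat \<bar>b1 i p\<bar> < nat \<bar>b i p\<bar>"
        using dec kl(1) by (intro bexI[of _ k]) (auto simp: b1_def)
    qed simp
    from less[of b1, OF this] obtain b' where b': "row_equiv d b1 b'" "\<forall>i<r. b' i = b1 i" "b' r p \<ge> 0"
      "\<forall>i. r < i \<and> i < d \<longrightarrow> b' i p = 0"
      "\<forall>j. (\<forall>i\<in>{r..<d}. b1 i j = 0) \<longrightarrow> (\<forall>i\<in>{r..<d}. b' i j = 0)"
      by blast
    have "\<forall>i<r. b1 i = b i" "\<forall>j. (\<forall>i\<in>{r..<d}. b i j = 0) \<longrightarrow> (\<forall>i\<in>{r..<d}. b1 i j = 0)"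
      using kl(1,2) by (auto simp: b1_def)
    then show ?thesis
      using b' row_equiv_trans[OF b'(1) eq] by (intro exI[of _ b']) auto
  next
    case False
    \<comment> \<open>Any two entries are comparable in absolute value, so at most one of them is non-zero.\<close>
    then have unique: "k = l" if "k \<in> {r..<d}" "l \<in> {r..<d}" "b k p \<noteq> 0" "b l p \<noteq> 0" for k l
      using that by (metis linear)
    have "\<exists>b1. row_equiv d b b1 \<and> (\<forall>i<r. b1 i = b i) \<and>
      (\<forall>i. r < i \<and> i < d \<longrightarrow> b1 i p = 0) \<and>
      (\<forall>j. (\<forall>i\<in>{r..<d}. b i j = 0) \<longrightarrow> (\<forall>i\<in>{r..<d}. b1 i j = 0))"
    proof (cases "\<exists>k. r < k \<and> k < d \<and> b k p \<noteq> 0")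
      case True
      then obtain k where k: "r < k" "k < d" "b k p \<noteq> 0" by blast
      \<comment> \<open>Move the entry from row \<open>k\<close> to row \<open>r\<close>, where the entry is zero.\<close>
      define b1 where "b1 = b(r := \<lambda>j. b r j + 1 * b k j)"
      define b2 where "b2 = b1(k := \<lambda>j. b1 k j + (- 1) * b1 r j)"
      have "row_equiv d b b2"
        unfolding b2_def b1_def using k assms by (intro row_equiv.add row_equiv.refl) auto
      moreover have "b i p = 0" if "r \<le> i" "i < d" "i \<noteq> k" for i
        using unique[of i k] k that by auto
      ultimately show ?thesis
        using k assms by (intro exI[of _ b2]) (auto simp: b2_def b1_def)
    next
      case False
      then show ?thesis
        by (intro exI[of _ b]) (auto intro: row_equiv.refl)
    qed
    then obtain b1 where b1: "row_equiv d b b1" "\<forall>i<r. b1 i = b i"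
      "\<forall>i. r < i \<and> i < d \<longrightarrow> b1 i p = 0"
      "\<forall>j. (\<forall>i\<in>{r..<d}. b i j = 0) \<longrightarrow> (\<forall>i\<in>{r..<d}. b1 i j = 0)" by blast
    show ?thesis
    proof (cases "b1 r p \<ge> 0")
      case True
      then show ?thesis using b1 by blast
    next
      case False
      then show ?thesis
        using b1 row_equiv.negate[OF b1(1) assms]
        by (intro exI[of _ "b1(r := \<lambda>j. - b1 r j)"]) auto
    qed
  qed
qed

section \<open>Positive lattice vectors of minimal support\<close>

text \<open>Subtract from \<open>y\<close> the multiple \<open>(y i / v i) v\<close> for the index \<open>i\<close> where this ratio is smallest
  and clear denominators. The result is non-negative and vanishes at \<open>i\<close>, so minimality of the
  support of \<open>v\<close> forces it to be zero.\<close>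

lemma minimal_support_proportional:
  fixes v y :: "nat \<Rightarrow> int"
  assumes "finite S"
    and closed: "\<And>x y s t. x \<in> L \<Longrightarrow> y \<in> L \<Longrightarrow> (\<lambda>j. s * x j + t * y j) \<in> L"
    and v: "v \<in> L" "\<forall>j\<in>S. v j \<ge> 0"
    and minimal: "\<And>z. z \<in> L \<Longrightarrow> \<forall>j\<in>S. z j \<ge> 0 \<Longrightarrow> \<exists>j\<in>S. z j > 0 \<Longrightarrow>
      card {j\<in>S. v j > 0} \<le> card {j\<in>S. z j > 0}"
    and y: "y \<in> L" "\<forall>j\<in>S. v j = 0 \<longrightarrow> y j = 0"
    and "p \<in> S" "j \<in> S" "v p > 0"
  shows "v p * y j = y p * v j"
proof -
  let ?T = "{j\<in>S. v j > 0}"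
  let ?f = "\<lambda>i. real_of_int (y i) / real_of_int (v i)"
  have "finite ?T" "?T \<noteq> {}" using assms by auto
  then obtain i where i: "i \<in> ?T" "\<And>k. k \<in> ?T \<Longrightarrow> ?f i \<le> ?f k"
    using ex_is_arg_min_if_finite[of ?T ?f] unfolding is_arg_min_linorder by blast
  define z where "z = (\<lambda>j. v i * y j + (- y i) * v j)"
  have z: "z \<in> L" unfolding z_def using y(1) v(1) by (rule closed)
  have nonneg: "\<forall>k\<in>S. z k \<ge> 0"
  proof
    fix k assume k: "k \<in> S"
    show "z k \<ge> 0"
    proof (cases "v k > 0")
      case True
      then have "?f i \<le> ?f k" using i(2) k by blast
      then have "real_of_int (y i * v k) \<le> real_of_int (v i * y k)"
        using True i(1) by (simp add: field_simps)
      then show ?thesis unfolding z_def by linarith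
    next
      case False
      then have "v k = 0" using v(2) k by force
      then show ?thesis unfolding z_def using y(2) k by simp
    qed
  qed
  have zero: "z k = 0" if "k \<in> S" for k
  proof (rule ccontr)
    assume "z k \<noteq> 0"
    then have "\<exists>k\<in>S. z k > 0" using that nonneg by force
    from minimal[OF z nonneg this] have "card ?T \<le> card {j\<in>S. z j > 0}" .
    moreover have "{j\<in>S. z j > 0} \<subseteq> ?T - {i}"
    proof
      fix l assume l: "l \<in> {j\<in>S. z j > 0}"
      have "l \<noteq> i" using l unfolding z_def by auto
      moreover have "v l \<noteq> 0" using l y(2) unfolding z_def by auto
      ultimately show "l \<in> ?T - {i}" using l v(2) by force
    qed
    then have "card {j\<in>S. z j > 0} < card ?T"
      using i(1) \<open>finite ?T\<close> by (intro psubset_card_mono) auto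
    ultimately show False by simp
  qed
  have j: "v i * y j = y i * v j" and p: "v i * y p = y i * v p"
    using zero[OF \<open>j \<in> S\<close>] zero[OF \<open>p \<in> S\<close>] unfolding z_def by auto
  have "v i * (v p * y j) = v i * (y p * v j)"
    using j p by (metis mult.assoc mult.commute)
  then show ?thesis using i(1) by simp
qed

section \<open>Positive echelon form up to the order of the columns\<close>

text \<open>The list \<open>js\<close> says in which order the columns are read, \<open>r\<close> is the number of non-zero rows, and
  \<open>p i\<close> is the position in \<open>js\<close>, rather than the column number, of the pivot of row \<open>i\<close>.\<close>

definition positive_echelon ::
  "nat \<Rightarrow> nat list \<Rightarrow> nat \<Rightarrow> (nat \<Rightarrow> nat) \<Rightarrow> (nat \<Rightarrow> nat \<Rightarrow> int) \<Rightarrow> bool" where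
  "positive_echelon d js r p b \<longleftrightarrow>
     r \<le> d \<and>
     (\<forall>i<r. p i < length js \<and> (\<forall>k<i. p k < p i) \<and>
        b i (js ! p i) \<noteq> 0 \<and> (\<forall>t<p i. b i (js ! t) = 0)) \<and>
     (\<forall>i<d. \<forall>j\<in>set js. b i j \<ge> 0) \<and>
     (\<forall>i\<in>{r..<d}. \<forall>j\<in>set js. b i j = 0)"

text \<open>Evaluate the relation at the pivot of row \<open>i\<close>: the earlier rows drop out by induction, and the
  later rows are zero there because their pivots lie further to the right.\<close>

lemma positive_echelon_independent:
  assumes "positive_echelon d js r p b"
    and "\<forall>j\<in>set js. (\<Sum>i<r. c i * b i j) = 0"
    and "i < r"
  shows "c i = 0"
  using assms(3)
proof (induction i rule: less_induct)
  case (less i)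
  let ?j = "js ! p i"
  have zero: "c k * b k ?j = 0" if "k < r" "k \<noteq> i" for k
  proof (cases "k < i")
    case True
    then show ?thesis using less by simp
  next
    case False
    then have "p i < p k" using that assms(1) unfolding positive_echelon_def by auto
    then show ?thesis using that assms(1) unfolding positive_echelon_def by auto
  qed
  have "(\<Sum>k<r. c k * b k ?j) = (\<Sum>k<r. if k = i then c i * b i ?j else 0)"
    using zero by (intro sum.cong) auto
  also have "\<dots> = c i * b i ?j" using less.prems by simp
  finally have "c i * b i ?j = 0"
    using assms(1,2) less.prems unfolding positive_echelon_def by force
  then show ?case using assms(1) less.prems unfolding positive_echelon_def by auto
qed

text \<open>The conditions on \<open>w\<close> are inherited by subsets of \<open>S\<close>, so the induction can pass to \<open>S - T\<close>,
  and unless all columns in \<open>S\<close> are zero, \<open>w\<close> shows that there are non-zero non-negative vectors to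
  minimize over.\<close>

lemma positive_echelon_form_exists:
  assumes "finite S"
    and "w \<in> row_combinations d a" "\<forall>j\<in>S. w j \<ge> 0"
    and "\<forall>j\<in>S. w j = 0 \<longrightarrow> (\<forall>i<d. a i j = 0)"
  shows "\<exists>b js r p. row_equiv d a b \<and> distinct js \<and> set js = S \<and> positive_echelon d js r p b"
  using assms
proof (induction "card S" arbitrary: S rule: less_induct)
  case less
  show ?case
  proof (cases "\<forall>j\<in>S. w j = 0")
    case True
    then have "positive_echelon d (sorted_list_of_set S) 0 p a" for p
      using less.prems unfolding positive_echelon_def by auto
    then show ?thesis
      using less.prems(1) row_equiv.refl[of d a]
      by (intro exI[of _ a] exI[of _ "sorted_list_of_set S"]) auto
  next
    case False
    let ?P = "\<lambda>x. x \<in> row_combinations d a \<and> (\<forall>j\<in>S. x j \<ge> 0) \<and> (\<exists>j\<in>S. x j > 0)"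
    have "?P w" using less.prems False by force
    from ex_has_least_nat[of ?P, OF this, of "\<lambda>x. card {j\<in>S. x j > 0}"]
    obtain v where v: "v \<in> row_combinations d a" "\<forall>j\<in>S. v j \<ge> 0" "\<exists>j\<in>S. v j > 0"
      and minimal: "\<And>z. z \<in> row_combinations d a \<Longrightarrow> \<forall>j\<in>S. z j \<ge> 0 \<Longrightarrow> \<exists>j\<in>S. z j > 0 \<Longrightarrow>
        card {j\<in>S. v j > 0} \<le> card {j\<in>S. z j > 0}" by blast
    define T where "T = {j\<in>S. v j > 0}"
    obtain q where q: "q \<in> S" "v q > 0" using v(3) by blast
    have "card (S - T) < card S"
      using q less.prems(1) unfolding T_def by (intro psubset_card_mono) auto
    from less.hyps[OF this] obtain b js r p where b: "row_equiv d a b" "distinct js"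
      "set js = S - T" "positive_echelon d js r p b"
      using less.prems by (metis DiffD1 finite_Diff)
    have r: "r \<le> d" using b(4) unfolding positive_echelon_def by auto
    have v0: "v j = 0" if "j \<in> set js" for j
      using that v(2) unfolding b(3) T_def by force
    \<comment> \<open>Used twice: it shows that there is a row after the first \<open>r\<close> rows, and that elimination does
      not turn all of these further rows into zero.\<close>
    have indep: False if eq: "row_equiv d a b'" "\<And>i. i < r \<Longrightarrow> b' i = b i"
      "\<And>i j. i \<in> {r..<d} \<Longrightarrow> j \<in> S \<Longrightarrow> b' i j = 0" for b'
    proof -
      have "v \<in> row_combinations d b'" using v(1) row_equiv_lattice[OF eq(1)] by simp
      then obtain c where c: "\<And>j. v j = (\<Sum>i<d. c i * b' i j)"
        unfolding row_combinations_def by blast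
      have vS: "v j = (\<Sum>i<r. c i * b i j)" if "j \<in> S" for j
      proof -
        have "v j = (\<Sum>i\<in>{..<r}. c i * b' i j)"
          unfolding c using that r eq(3) by (intro sum.mono_neutral_right) auto
        then show ?thesis using eq(2) by simp
      qed
      then have "\<forall>j\<in>set js. (\<Sum>i<r. c i * b i j) = 0"
        using v0 b(3) by auto
      then have "c i = 0" if "i < r" for i
        using positive_echelon_independent[OF b(4) _ that] by blast
      then show False using vS[OF q(1)] q(2) by simp
    qed
    have rd: "r < d"
    proof (rule ccontr)
      assume "\<not> r < d"
      then show False using indep[OF b(1)] by auto
    qed
    obtain b' where b': "row_equiv d b b'" "\<forall>i<r. b' i = b i" "b' r q \<ge> 0"
      "\<forall>i. r < i \<and> i < d \<longrightarrow> b' i q = 0"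
      "\<forall>j. (\<forall>i\<in>{r..<d}. b i j = 0) \<longrightarrow> (\<forall>i\<in>{r..<d}. b' i j = 0)"
      using column_elimination[OF rd] by blast
    have ab': "row_equiv d a b'" using row_equiv_trans[OF b'(1) b(1)] .
    have b'0: "b' i j = 0" if "i \<in> {r..<d}" "j \<in> set js" for i j
      using b'(5) b(4) that unfolding positive_echelon_def by blast
    have proportional: "v q * b' i j = b' i q * v j" if "i \<in> {r..<d}" "j \<in> S" for i j
    proof (rule minimal_support_proportional[where L = "row_combinations d a" and S = S])
      show "b' i \<in> row_combinations d a"
        using row_combinations_row[of i d b'] row_equiv_lattice[OF ab'] that by simp
      show "\<forall>j\<in>S. v j = 0 \<longrightarrow> b' i j = 0"
        using b'0 that(1) b(3) unfolding T_def by auto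
    qed (use less.prems v minimal q that row_combinations_lincomb in auto)
    \<comment> \<open>A multiple of \<open>v\<close> is determined by its entry in column \<open>q\<close>, where \<open>v\<close> is positive.\<close>
    have below: "b' i j = 0" if "r < i" "i < d" "j \<in> S" for i j
      using proportional[of i j] that b'(4) q(2) by auto
    have pos: "b' r q > 0"
    proof (rule ccontr)
      assume "\<not> b' r q > 0"
      then have "b' r j = 0" if "j \<in> S" for j
        using proportional[of r j] that rd b'(3) q(2) by auto
      then have "b' i j = 0" if "i \<in> {r..<d}" "j \<in> S" for i j
        using below[of i j] that by (cases "i = r") auto
      then show False using indep[OF ab'] b'(2) by blast
    qed
    have rT: "b' r j > 0" if "j \<in> T" for j
    proof -
      have "v q * b' r j > 0"
        using proportional[of r j] that rd pos unfolding T_def by simp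
      then show ?thesis using q(2) by (simp add: zero_less_mult_iff)
    qed
    \<comment> \<open>The entries of row \<open>r\<close> on \<open>T\<close> are at least 1, so \<open>N\<close> copies of it outweigh every
      negative entry of the rows above.\<close>
    define N where "N = (\<Sum>i<r. \<Sum>j\<in>T. \<bar>b i j\<bar>)"
    have finT: "finite T" using less.prems(1) unfolding T_def by simp
    have N: "\<bar>b i j\<bar> \<le> N" if "i < r" "j \<in> T" for i j
    proof -
      have "\<bar>b i j\<bar> \<le> (\<Sum>j\<in>T. \<bar>b i j\<bar>)"
        using that finT by (intro member_le_sum) auto
      also have "\<dots> \<le> N"
        unfolding N_def using that by (intro member_le_sum sum_nonneg) auto
      finally show ?thesis .
    qed
    define b2 where "b2 = (\<lambda>i. if i < r then (\<lambda>j. b' i j + N * b' r j) else b' i)"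
    define ks where "ks = sorted_list_of_set T"
    have ks: "set ks = T" "distinct ks" "ks \<noteq> []"
      using finT q unfolding ks_def T_def by auto
    have ab2: "row_equiv d a b2"
      unfolding b2_def
      using row_equiv_trans[OF row_equiv_add_to_upper_rows[OF rd le_refl] ab'] .
    have b2_js: "b2 i j = b i j" if "i < r" "j \<in> set js" for i j
      using that b'(2) b'0[of r j] rd unfolding b2_def by simp
    have b2_low: "b2 i = b' i" if "i \<ge> r" for i
      using that unfolding b2_def by simp
    have "positive_echelon d (js @ ks) (Suc r) (p(r := length js)) b2"
      unfolding positive_echelon_def
    proof (intro conjI)
      show "Suc r \<le> d" using rd by simp
      show "\<forall>i<Suc r. (p(r := length js)) i < length (js @ ks) \<and>
          (\<forall>k<i. (p(r := length js)) k < (p(r := length js)) i) \<and>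
          b2 i ((js @ ks) ! (p(r := length js)) i) \<noteq> 0 \<and>
          (\<forall>t<(p(r := length js)) i. b2 i ((js @ ks) ! t) = 0)"
      proof (intro allI impI)
        fix i assume i: "i < Suc r"
        show "(p(r := length js)) i < length (js @ ks) \<and>
          (\<forall>k<i. (p(r := length js)) k < (p(r := length js)) i) \<and>
          b2 i ((js @ ks) ! (p(r := length js)) i) \<noteq> 0 \<and>
          (\<forall>t<(p(r := length js)) i. b2 i ((js @ ks) ! t) = 0)"
        proof (cases "i = r")
          case True
          have "b2 r (ks ! 0) > 0"
            using rT[of "ks ! 0"] ks b2_low[of r] by (metis le_refl length_greater_0_conv nth_mem)
          moreover have "b2 r (js ! t) = 0" if "t < length js" for t
            using b'0[of r "js ! t"] that rd b2_low[of r] by simp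
          ultimately show ?thesis
            using True ks(3) b(4) unfolding positive_echelon_def by (auto simp: nth_append)
        next
          case False
          then have ir: "i < r" using i by simp
          then have p: "p i < length js" "\<forall>k<i. p k < p i" "b i (js ! p i) \<noteq> 0"
            "\<forall>t<p i. b i (js ! t) = 0"
            using b(4) unfolding positive_echelon_def by auto
          then show ?thesis
            using ir False b2_js[OF ir] by (auto simp: nth_append)
        qed
      qed
      show "\<forall>i<d. \<forall>j\<in>set (js @ ks). 0 \<le> b2 i j"
      proof (intro allI impI ballI)
        fix i j assume i: "i < d" and j: "j \<in> set (js @ ks)"
        consider "i < r" "j \<in> set js" | "i < r" "j \<in> T" | "i = r" "j \<in> set js"
          | "i = r" "j \<in> T" | "i > r"
          using j ks(1) by fastforce
        then show "0 \<le> b2 i j"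
        proof cases
          case 1
          then show ?thesis
            using b2_js b(4) i unfolding positive_echelon_def by auto
        next
          case 2
          have "N * 1 \<le> N * b' r j"
            using rT[OF 2(2)] N[OF 2] by (intro mult_left_mono) auto
          then show ?thesis
            using N[OF 2] 2 b'(2) unfolding b2_def by simp
        next
          case 3
          then show ?thesis using b'0[of r j] rd b2_low by simp
        next
          case 4
          then show ?thesis using rT[of j] b2_low by simp
        next
          case 5
          then have "j \<in> S" using j ks(1) b(3) unfolding T_def by auto
          then show ?thesis using below 5 i b2_low by simp
        qed
      qed
      show "\<forall>i\<in>{Suc r..<d}. \<forall>j\<in>set (js @ ks). b2 i j = 0"
        using below b2_low ks(1) b(3) unfolding T_def by auto
    qed
    moreover have "distinct (js @ ks)" "set (js @ ks) = S"
      using b(2,3) ks unfolding T_def by auto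
    ultimately show ?thesis using ab2 by blast
  qed
qed

section \<open>Integral invertible matrices and column permutations\<close>

lemma GL_I:
  assumes "P \<in> carrier_mat n n" "Q \<in> carrier_mat n n" "P * Q = 1\<^sub>m n" "Q * P = 1\<^sub>m n"
  shows "P \<in> GL n"
  using assms unfolding GL_def invertible_mat_def inverts_mat_def by auto

lemma GL_E:
  assumes "P \<in> GL n"
  obtains Q where "P \<in> carrier_mat n n" "Q \<in> carrier_mat n n" "P * Q = 1\<^sub>m n" "Q * P = 1\<^sub>m n"
proof -
  have P: "P \<in> carrier_mat n n" using assms unfolding GL_def by blast
  obtain Q where Q: "P * Q = 1\<^sub>m (dim_row P)" "Q * P = 1\<^sub>m (dim_row Q)"
    using assms unfolding GL_def invertible_mat_def inverts_mat_def by blast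
  have "dim_col Q = n" using arg_cong[OF Q(1), of dim_col] P by simp
  moreover have "dim_row Q = n" using arg_cong[OF Q(2), of dim_col] P by simp
  ultimately show thesis using that[OF P, of Q] Q P by auto
qed

lemma GL_mult:
  assumes "P \<in> GL n" "Q \<in> GL n"
  shows "P * Q \<in> GL n"
proof -
  obtain P' where P: "P \<in> carrier_mat n n" "P' \<in> carrier_mat n n" "P * P' = 1\<^sub>m n" "P' * P = 1\<^sub>m n"
    using GL_E[OF assms(1)] .
  obtain Q' where Q: "Q \<in> carrier_mat n n" "Q' \<in> carrier_mat n n" "Q * Q' = 1\<^sub>m n" "Q' * Q = 1\<^sub>m n"
    using GL_E[OF assms(2)] .
  have "R * S * (T * U) = R * (S * T * U)"
    if "R \<in> carrier_mat n n" "S \<in> carrier_mat n n" "T \<in> carrier_mat n n" "U \<in> carrier_mat n n"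
    for R S T U :: "int mat"
    using that by (simp add: assoc_mult_mat[of _ n n _ n _ n])
  then have "P * Q * (Q' * P') = P * (Q * Q' * P')" "Q' * P' * (P * Q) = Q' * (P' * P * Q)"
    using P(1,2) Q(1,2) by blast+
  then show ?thesis
    using P Q by (intro GL_I[of _ n "Q' * P'"]) auto
qed

lemma row_equiv_GL:
  assumes "row_equiv d a b"
  shows "\<exists>\<alpha>\<in>GL d. \<alpha> * mat d m (\<lambda>(i, j). a i j) = mat d m (\<lambda>(i, j). b i j)"
  using assms
proof induction
  case refl
  have "1\<^sub>m d \<in> GL d" by (rule GL_I[of _ d "1\<^sub>m d"]) auto
  then show ?case by (intro bexI[of _ "1\<^sub>m d"]) auto
next
  case (add b k l c)
  let ?A = "mat d m (\<lambda>(i, j). a i j)"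
  let ?E = "addrow_mat d c k l"
  obtain \<alpha> where \<alpha>: "\<alpha> \<in> GL d" "\<alpha> * ?A = mat d m (\<lambda>(i, j). b i j)"
    using add.IH by blast
  have E: "?E \<in> GL d"
    using addrow_mat_inv[OF add.hyps(2-4), of c] addrow_mat_inv[OF add.hyps(2-4), of "-c"]
    by (intro GL_I[of _ d "addrow_mat d (-c) k l"]) auto
  have "?E * \<alpha> * ?A = ?E * (\<alpha> * ?A)"
    using \<alpha>(1) unfolding GL_def by (intro assoc_mult_mat[of _ d d _ d _ m]) auto
  also have "\<dots> = addrow c k l (mat d m (\<lambda>(i, j). b i j))"
    unfolding \<alpha>(2) using add.hyps by (subst addrow_mat[of _ d m]) auto
  also have "\<dots> = mat d m (\<lambda>(i, j). (b(k := \<lambda>j. b k j + c * b l j)) i j)"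
    using add.hyps by (intro eq_matI) auto
  finally show ?case
    using GL_mult[OF E \<alpha>(1)] by blast
next
  case (negate b k)
  let ?A = "mat d m (\<lambda>(i, j). a i j)"
  let ?E = "multrow_mat d k (-1 :: int)"
  obtain \<alpha> where \<alpha>: "\<alpha> \<in> GL d" "\<alpha> * ?A = mat d m (\<lambda>(i, j). b i j)"
    using negate.IH by blast
  have "?E * ?E = multrow k (-1) ?E"
    by (subst multrow_mat[of _ d d]) auto
  also have "\<dots> = 1\<^sub>m d" by (intro eq_matI) auto
  finally have E: "?E \<in> GL d" by (intro GL_I[of _ d ?E]) auto
  have "?E * \<alpha> * ?A = ?E * (\<alpha> * ?A)"
    using \<alpha>(1) unfolding GL_def by (intro assoc_mult_mat[of _ d d _ d _ m]) auto
  also have "\<dots> = multrow k (-1) (mat d m (\<lambda>(i, j). b i j))"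
    unfolding \<alpha>(2) by (subst multrow_mat[of _ d m]) auto
  also have "\<dots> = mat d m (\<lambda>(i, j). (b(k := \<lambda>j. - b k j)) i j)"
    by (intro eq_matI) auto
  finally show ?case
    using GL_mult[OF E \<alpha>(1)] by blast
qed

definition perm_mat :: "nat \<Rightarrow> (nat \<Rightarrow> nat) \<Rightarrow> int mat" where
  "perm_mat n \<pi> = mat n n (\<lambda>(i, j). if i = \<pi> j then 1 else 0)"

lemma mult_perm_mat:
  assumes "\<pi> permutes {..<m}" "A \<in> carrier_mat d m"
  shows "A * perm_mat m \<pi> = mat d m (\<lambda>(i, j). A $$ (i, \<pi> j))"
proof (rule eq_matI)
  fix i j
  assume "i < dim_row (mat d m (\<lambda>(i, j). A $$ (i, \<pi> j)))"
    and "j < dim_col (mat d m (\<lambda>(i, j). A $$ (i, \<pi> j)))"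
  then have ij: "i < d" "j < m" by auto
  have "\<pi> j < m" using permutes_in_image[OF assms(1), of j] ij by simp
  then show "(A * perm_mat m \<pi>) $$ (i, j) = mat d m (\<lambda>(i, j). A $$ (i, \<pi> j)) $$ (i, j)"
    using ij assms(2)
    by (simp add: perm_mat_def scalar_prod_def if_distrib[of "(*) _"] cong: if_cong)
qed (use assms(2) in \<open>auto simp: perm_mat_def\<close>)

lemma perm_mat_GL:
  assumes "\<pi> permutes {..<m}"
  shows "perm_mat m \<pi> \<in> GL m"
proof -
  have inv: "perm_mat m \<pi> * perm_mat m \<sigma> = 1\<^sub>m m"
    if "\<pi> permutes {..<m}" "\<sigma> permutes {..<m}" "\<And>j. \<pi> (\<sigma> j) = j" for \<pi> \<sigma>
  proof -
    have "\<sigma> j < m" if "j < m" for j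
      using permutes_in_image[OF \<open>\<sigma> permutes {..<m}\<close>, of j] that by simp
    then show ?thesis
      using that by (subst mult_perm_mat[of _ _ _ m]) (auto simp: perm_mat_def intro!: eq_matI)
  qed
  show ?thesis
    using inv[OF assms permutes_inv[OF assms]] inv[OF permutes_inv[OF assms] assms]
      permutes_inverses[OF assms]
    by (intro GL_I[of _ m "perm_mat m (inv_into UNIV \<pi>)"]) (auto simp: perm_mat_def)
qed

lemma distinct_list_permutes:
  assumes "distinct js" "set js = {..<m}"
  shows "(\<lambda>j. if j < m then js ! j else j) permutes {..<m}"
proof -
  have len: "length js = m" using assms distinct_card by fastforce
  have "bij_betw ((!) js) {..<m} {..<m}"
    by (rule bij_betw_nth) (use assms len in simp_all)
  moreover have "bij_betw ((!) js) {..<m} {..<m} \<longleftrightarrow>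
      bij_betw (\<lambda>j. if j < m then js ! j else j) {..<m} {..<m}"
    by (rule bij_betw_cong) simp
  ultimately show ?thesis
    by (intro bij_imp_permutes) auto
qed

lemma positive_echelon_mat:
  assumes ech: "positive_echelon d js r p b" and "set js = {..<m}" "length js = m"
  defines "A' \<equiv> mat d m (\<lambda>(i, j). b i (js ! j))"
  shows "positive_mat A'" "row_echelon A'"
proof -
  have js: "js ! j \<in> set js" if "j < m" for j using that assms(3) by simp
  have dims: "dim_row A' = d" "dim_col A' = m" unfolding A'_def by auto
  show "positive_mat A'"
    unfolding positive_mat_def A'_def using ech js unfolding positive_echelon_def by auto
  have pivot: "p i < m" "b i (js ! p i) \<noteq> 0" "\<And>t. t < p i \<Longrightarrow> b i (js ! t) = 0" "i < d"
    if "i < r" for i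
    using ech that assms(3) unfolding positive_echelon_def by auto
  have zero_row: "row A' i = 0\<^sub>v m \<longleftrightarrow> r \<le> i" if "i < d" for i
  proof
    assume "r \<le> i"
    then show "row A' i = 0\<^sub>v m"
      using ech js \<open>i < d\<close> unfolding positive_echelon_def A'_def by (intro eq_vecI) auto
  next
    assume zero: "row A' i = 0\<^sub>v m"
    show "r \<le> i"
    proof (rule ccontr)
      assume "\<not> r \<le> i"
      then have "row A' i $ p i \<noteq> 0\<^sub>v m $ p i"
        using pivot[of i] unfolding A'_def by simp
      then show False using zero by metis
    qed
  qed
  have leading: "leading_col A' i = p i" if "i < r" for i
    unfolding leading_col_def A'_def
    using pivot[OF that] by (intro Least_equality) (auto simp: not_less[symmetric])
  have "p i < p (Suc i)" if "Suc i < r" for i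
    using ech that unfolding positive_echelon_def by auto
  then show "row_echelon A'"
    using zero_row leading dims unfolding row_echelon_def by auto
qed

section \<open>W-positive matrices\<close>

text \<open>Minimality of the span, with closure stated in terms of the vector operations so that it can be
  applied to sets given by a condition on the entries.\<close>

lemma int_span_subset:
  assumes "X \<subseteq> N" "N \<subseteq> carrier_vec m" "0\<^sub>v m \<in> N"
    and "\<And>x y. x \<in> N \<Longrightarrow> y \<in> N \<Longrightarrow> x + y \<in> N" "\<And>c x. x \<in> N \<Longrightarrow> c \<cdot>\<^sub>v x \<in> N"
  shows "int_span m X \<subseteq> N"
proof -
  interpret vec_module "TYPE(int)" m .
  show ?thesis
  proof (rule span_is_subset[OF assms(1)])
    show "submodule class_ring N V"
      using assms(2-5) module_axioms by unfold_locales (auto simp: module_vec_simps)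
  qed
qed

text \<open>If the basis vectors all vanished at column \<open>k\<close>, so would their span and with it the rows of
  \<open>A\<close>. So for a non-zero column \<open>k\<close> some basis vector is positive at \<open>k\<close>, and \<open>w\<close> is the sum of
  one such vector for each non-zero column.\<close>

lemma W_positive_vector:
  assumes A: "A \<in> carrier_mat d m" and "W_positive A"
  shows "\<exists>w\<in>row_combinations d (\<lambda>i j. A $$ (i, j)). (\<forall>j<m. w j \<ge> 0) \<and>
    (\<forall>j<m. w j = 0 \<longrightarrow> (\<forall>i<d. A $$ (i, j) = 0))"
proof -
  interpret vec_module "TYPE(int)" m .
  let ?L = "row_combinations d (\<lambda>i j. A $$ (i, j))"
  obtain B where B: "B \<subseteq> carrier_vec m" "int_span m B = int_span m (set (rows A))"
    "\<forall>v\<in>B. positive_vec v"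
    using assms unfolding W_positive_def int_basis_def row_lattice_def by auto
  have rows: "set (rows A) \<subseteq> carrier_vec m" using A by (auto simp: rows_def)
  have "int_span m (set (rows A)) \<subseteq> {x \<in> carrier_vec m. \<exists>y\<in>?L. \<forall>j<m. x $ j = y j}"
  proof (rule int_span_subset)
    show "set (rows A) \<subseteq> {x \<in> carrier_vec m. \<exists>y\<in>?L. \<forall>j<m. x $ j = y j}"
      using A row_combinations_row[of _ d "\<lambda>i j. A $$ (i, j)"] by (fastforce simp: rows_def)
  next
    show "0\<^sub>v m \<in> {x \<in> carrier_vec m. \<exists>y\<in>?L. \<forall>j<m. x $ j = y j}"
      using row_combinations_sum[of "{}" _ d "\<lambda>i j. A $$ (i, j)"] by force
  next
    fix x y assume x: "x \<in> {x \<in> carrier_vec m. \<exists>y\<in>?L. \<forall>j<m. x $ j = y j}"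
      and y: "y \<in> {x \<in> carrier_vec m. \<exists>y\<in>?L. \<forall>j<m. x $ j = y j}"
    then obtain x' y' where xy: "x' \<in> ?L" "\<forall>j<m. x $ j = x' j" "y' \<in> ?L" "\<forall>j<m. y $ j = y' j"
      by blast
    show "x + y \<in> {x \<in> carrier_vec m. \<exists>y\<in>?L. \<forall>j<m. x $ j = y j}"
      using x y xy(2,4) by (auto intro!: bexI[OF _ row_combinations_lincomb[OF xy(1,3), of 1 1]])
  next
    fix c x assume x: "x \<in> {x \<in> carrier_vec m. \<exists>y\<in>?L. \<forall>j<m. x $ j = y j}"
    then obtain x' where x': "x' \<in> ?L" "\<forall>j<m. x $ j = x' j" by blast
    show "c \<cdot>\<^sub>v x \<in> {x \<in> carrier_vec m. \<exists>y\<in>?L. \<forall>j<m. x $ j = y j}"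
      using x x'(2) by (auto intro!: bexI[OF _ row_combinations_lincomb[OF x'(1) x'(1), of c 0]])
  qed auto
  then have BL: "\<exists>y\<in>?L. \<forall>j<m. x $ j = y j" if "x \<in> B" for x
    using in_own_span[OF B(1)] B(2) that by auto
  define J where "J = {j. j < m \<and> (\<exists>i<d. A $$ (i, j) \<noteq> 0)}"
  have "\<exists>y\<in>?L. (\<forall>j<m. y j \<ge> 0) \<and> y k > 0" if "k \<in> J" for k
  proof -
    obtain i where i: "k < m" "i < d" "A $$ (i, k) \<noteq> 0" using \<open>k \<in> J\<close> unfolding J_def by blast
    have "\<exists>x\<in>B. x $ k \<noteq> 0"
    proof (rule ccontr)
      assume "\<not> (\<exists>x\<in>B. x $ k \<noteq> 0)"
      then have "int_span m B \<subseteq> {x \<in> carrier_vec m. x $ k = 0}"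
        using B(1) i(1) by (intro int_span_subset) auto
      moreover have "row A i \<in> int_span m B"
        unfolding B(2) using in_own_span[OF rows] A i(2) by (auto simp: rows_def)
      ultimately show False using A i by auto
    qed
    then obtain x where x: "x \<in> B" "x $ k \<noteq> 0" by blast
    obtain y where y: "y \<in> ?L" "\<forall>j<m. x $ j = y j" using BL[OF x(1)] by blast
    have "\<forall>j<m. x $ j \<ge> 0" using x(1) B(1,3) unfolding positive_vec_def by auto
    then show ?thesis using y x(2) i(1) by (intro bexI[of _ y]) force+
  qed
  then obtain f where f: "\<And>k. k \<in> J \<Longrightarrow> f k \<in> ?L" "\<And>k j. k \<in> J \<Longrightarrow> j < m \<Longrightarrow> f k j \<ge> 0"
    "\<And>k. k \<in> J \<Longrightarrow> f k k > 0" by metis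
  have fin: "finite J" unfolding J_def by simp
  define w where "w = (\<lambda>j. \<Sum>k\<in>J. f k j)"
  have "w \<in> ?L" unfolding w_def using fin f(1) by (rule row_combinations_sum)
  moreover have "w j \<ge> 0" if "j < m" for j
    unfolding w_def using f(2) that by (intro sum_nonneg) auto
  moreover have "w j > 0" if "j \<in> J" for j
  proof -
    have "j < m" using that unfolding J_def by blast
    then show ?thesis
      unfolding w_def using fin f(2,3) that by (intro sum_pos2[of _ j]) auto
  qed
  ultimately show ?thesis
    unfolding J_def by (intro bexI[of _ w]) force+
qed

theorem theorem3p18:
  fixes d m :: nat and A :: "int mat"
  assumes "d > 0" and "m > 0"
    and "A \<in> carrier_mat d m"
    and "W_positive A"
  shows "\<exists>\<alpha> \<beta> A'. \<alpha> \<in> GL d \<and> \<beta> \<in> GL m \<and> permutation_mat m \<beta> \<and>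
           A' \<in> carrier_mat d m \<and> positive_mat A' \<and> row_echelon A' \<and>
           \<alpha> * A * \<beta> = A'"
proof -
  let ?a = "\<lambda>i j. A $$ (i, j)"
  obtain w where "w \<in> row_combinations d ?a" "\<forall>j<m. w j \<ge> 0" "\<forall>j<m. w j = 0 \<longrightarrow> (\<forall>i<d. ?a i j = 0)"
    using W_positive_vector[OF assms(3,4)] by blast
  then obtain b js r p where b: "row_equiv d ?a b" "distinct js" "set js = {..<m}"
    "positive_echelon d js r p b"
    using positive_echelon_form_exists[of "{..<m}" w d ?a] by auto
  have len: "length js = m" using b(2,3) distinct_card by fastforce
  obtain \<alpha> where \<alpha>: "\<alpha> \<in> GL d"
    "\<alpha> * mat d m (\<lambda>(i, j). ?a i j) = mat d m (\<lambda>(i, j). b i j)"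
    using row_equiv_GL[OF b(1)] by blast
  have "mat d m (\<lambda>(i, j). ?a i j) = A" using assms(3) by (intro eq_matI) auto
  then have \<alpha>A: "\<alpha> * A = mat d m (\<lambda>(i, j). b i j)" using \<alpha>(2) by simp
  define A' where "A' = mat d m (\<lambda>(i, j). b i (js ! j))"
  define \<pi> where "\<pi> = (\<lambda>j. if j < m then js ! j else j)"
  have \<pi>: "\<pi> permutes {..<m}"
    unfolding \<pi>_def using b(2,3) by (rule distinct_list_permutes)
  have "\<pi> j < m" if "j < m" for j
    using permutes_in_image[OF \<pi>, of j] that by simp
  then have "\<alpha> * A * perm_mat m \<pi> = A'"
    unfolding \<alpha>A by (subst mult_perm_mat[OF \<pi>, of _ d]) (auto simp: \<pi>_def A'_def)
  moreover have "A' \<in> carrier_mat d m" "positive_mat A'" "row_echelon A'"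
    using positive_echelon_mat[OF b(4,3) len] unfolding A'_def by auto
  moreover have "permutation_mat m (perm_mat m \<pi>)"
    unfolding permutation_mat_def perm_mat_def using \<pi> by blast
  ultimately show ?thesis
    using \<alpha>(1) perm_mat_GL[OF \<pi>] by blast
qed

end
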